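(* Let $\lambda\geq 2$ be an integer and let $\sigma$ be a $\lambda$-uniform substitution on the alphabet $\{a,b\}$ such that \[ |\sigma(a)|_a=|\sigma(b)|_a \quad\text{and}\quad |\sigma(a)|_b=|\sigma(b)|_b, \] and such that \[ \delta^{(1)}_{a\in\sigma(a)}-\delta^{(1)}_{a\in\sigma(b)}=1, \] where, for a letter $\beta\in\{a,b\}$, $\delta^{(1)}_{a\in\sigma(\beta)}:=\sum_{v\in \mathrm{pref}(\sigma(\beta))}|v|_a$. Let $u=u_0u_1u_2\cdots\in\{a,b\}^{\mathbb N}$ be an infinite word with $u=\sigma(u)$. Let $\mathcal S_\lambda$ be the set of functions $f:[0,+\infty)\to\mathbb R$ which satisfy \[ \int_{\lambda y}^{\lambda x} f(t)\,dt = f(x)-f(y)\quad\text{for every }(x,y)\in[0,+\infty)^2, \] and which are the concatenation of two continuous functions $f_a,f_b:[0,\lambda]\to\mathbb R$ along $u$, i.e. $f(x+\lambda k)=f_{u_k}(x)$ for all $x\in[0,\lambda]$ and all $k\in\mathbb N$. Then $\mathcal S_\lambda$ is a real vector space of dimension at most $2$.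
   Context: For a finite word $w$ over $\{a,b\}$, $|w|$ denotes its length and $|w|_\alpha$ the number of occurrences of the letter $\alpha$ in $w$. A substitution is a monoid endomorphism of the free monoid $\{a,b\}^*$ (under concatenation); it extends letterwise to infinite words, $\sigma(u_0u_1\cdots)=\sigma(u_0)\sigma(u_1)\cdots$. It is $\lambda$-uniform if $|\sigma(a)|=|\sigma(b)|=\lambda$. For a finite word $w=w_0\cdots w_{n-1}$ with $n>1$, the set of strict prefixes is $\mathrm{pref}(w)=\{w_0\cdots w_k : 0\le k< n-1\}$ (the nonempty prefixes of length $1,\dots,n-1$). Equivalently, writing $\sigma(\beta)=v_0\cdots v_{\lambda-1}$, one has $\delta^{(1)}_{a\in\sigma(\beta)}=\sum_{k=0}^{\lambda-1}(\lambda-k-1)\,\mathbf 1[v_k=a]$. *)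

theory Defs
  imports
    "HOL-Analysis.Analysis"
    "HOL-Library.Function_Algebras"
    "HOL-Library.Stream"
    "HOL-Library.Sublist"
begin

text \<open>Words over the alphabet \<open>{a, b}\<close> are lists, infinite words are streams; \<open>|w|\<^sub>\<alpha>\<close> is
  \<^term>\<open>count_list w \<alpha>\<close>.\<close>

datatype letter = La | Lb

definition substitution :: "(letter list \<Rightarrow> letter list) \<Rightarrow> bool" where
  "substitution \<sigma> \<longleftrightarrow> \<sigma> [] = [] \<and> (\<forall>v w. \<sigma> (v @ w) = \<sigma> v @ \<sigma> w)"

definition uniform_substitution :: "nat \<Rightarrow> (letter list \<Rightarrow> letter list) \<Rightarrow> bool" where
  "uniform_substitution l \<sigma> \<longleftrightarrow>
     substitution \<sigma> \<and> length (\<sigma> [La]) = l \<and> length (\<sigma> [Lb]) = l"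

text \<open>Since \<^const>\<open>flat\<close> is the concatenation of a stream of words only when these words are
  nonempty, the following is used for non-erasing substitutions only.\<close>

definition subst_infinite :: "(letter list \<Rightarrow> letter list) \<Rightarrow> letter stream \<Rightarrow> letter stream" where
  "subst_infinite \<sigma> u = flat (smap (\<lambda>c. \<sigma> [c]) u)"

definition pref :: "letter list \<Rightarrow> letter list set" where
  "pref w = {v. v \<noteq> [] \<and> strict_prefix v w}"

definition delta1 :: "letter \<Rightarrow> letter list \<Rightarrow> nat" where
  "delta1 \<alpha> w = (\<Sum>v\<in>pref w. count_list v \<alpha>)"

instantiation "fun" :: (type, real_vector) real_vector
begin

definition scaleR_fun :: "real \<Rightarrow> ('a \<Rightarrow> 'b) \<Rightarrow> 'a \<Rightarrow> 'b" where
  "scaleR_fun c f = (\<lambda>x. c *\<^sub>R f x)"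

instance
  by standard (simp_all add: scaleR_fun_def fun_eq_iff scaleR_add_right scaleR_add_left)

end

text \<open>A function \<open>[0, \<infinity>) \<rightarrow> \<real>\<close> is represented by its extension by \<open>0\<close> to the whole real line;
  this makes the representation unique and linear. In \<open>fun_space\<close> below, the concatenation
  condition at the common endpoints of consecutive intervals forces \<open>f\<close> to be continuous on
  \<open>[0, \<infinity>)\<close>, so that all the integrals exist; they are oriented.\<close>

definition concatenation_along ::
  "real \<Rightarrow> letter stream \<Rightarrow> (real \<Rightarrow> real) \<Rightarrow> (real \<Rightarrow> real) \<Rightarrow> (real \<Rightarrow> real) \<Rightarrow> bool" where
  "concatenation_along l u fa fb f \<longleftrightarrow>
     (\<forall>k. \<forall>x\<in>{0..l}. f (x + l * real k) = (case u !! k of La \<Rightarrow> fa x | Lb \<Rightarrow> fb x))"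

definition fun_space :: "nat \<Rightarrow> letter stream \<Rightarrow> (real \<Rightarrow> real) set" where
  "fun_space l u =
     {f. (\<forall>x<0. f x = 0) \<and>
         (\<forall>x\<ge>0. \<forall>y\<ge>0. (LBINT t=ereal (real l * y)..ereal (real l * x). f t) = f x - f y) \<and>
         (\<exists>fa fb. continuous_on {0..real l} fa \<and> continuous_on {0..real l} fb \<and>
                  concatenation_along (real l) u fa fb f)}"

end

theory Submission
  imports Defs
begin

text \<open>A function of the space satisfies \<open>f x - f y = \<integral> f\<close> over \<open>[l y, l x]\<close>. Hence, if \<open>f\<close> on the
  \<open>k\<close>-th block of length \<open>l m\<close> depends only on the letter \<open>u\<^sub>k\<close>, then so do the increments of \<open>f\<close> on
  the \<open>k\<close>-th block of length \<open>m\<close>; let \<open>G c\<close> be the total increment for the letter \<open>c\<close>. If moreover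
  \<open>f\<close> vanishes at the multiples of \<open>l m\<close>, then \<open>p G a + q G b = 0\<close>, where \<open>p\<close> and \<open>q\<close> count the
  letters of \<open>\<sigma>(a)\<close>, and integrating once more gives \<open>G a - G b = m \<delta> (G a - G b)\<close> with
  \<open>\<delta> = \<delta>(\<sigma>(a)) - \<delta>(\<sigma>(b)) = 1\<close>. So for \<open>m \<noteq> 1\<close> both increments are \<open>0\<close> and \<open>f\<close> vanishes at the
  multiples of \<open>m\<close>, whereas for \<open>m = 1\<close> one parameter stays free and has to be killed by \<open>f 1 = 0\<close>.
  Therefore \<open>f 0 = f 1 = 0\<close> forces \<open>f\<close> to vanish at all \<open>k / l\<^sup>n\<close>, that is \<open>f = 0\<close>, and
  \<open>f \<mapsto> (f 0, f 1)\<close> is injective.\<close>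

section \<open>Letter counts, prefixes and fixed points of uniform substitutions\<close>

lemma flat_snth_uniform:
  assumes "\<forall>xs \<in> sset s. length xs = l" "j < l"
  shows "flat s !! (l * k + j) = s !! k ! j"
  using assms(1)
proof (induction k arbitrary: s)
  case (0 s)
  have ne: "\<forall>xs \<in> sset s. xs \<noteq> []" using 0 assms(2) by fastforce
  have "length (shd s) = l" using 0 by (simp add: shd_sset)
  then show ?case using assms(2) by (simp add: flat_snth[OF ne])
next
  case (Suc k s)
  have ne: "\<forall>xs \<in> sset s. xs \<noteq> []" using Suc.prems assms(2) by fastforce
  have len: "length (shd s) = l" using Suc.prems by (simp add: shd_sset)
  have "\<forall>xs \<in> sset (stl s). length xs = l" using Suc.prems by (simp add: stl_sset)
  note IH = Suc.IH[OF this]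
  have "flat s !! (l * Suc k + j) = flat (stl s) !! (l * k + j)"
    by (simp only: flat_snth[OF ne] len) simp
  then show ?case using IH by simp
qed

text \<open>This is the only form in which the fixed-point equation is used: the \<open>k\<close>-th
  block of \<open>l\<close> letters of \<open>u\<close> spells the image of the \<open>k\<close>-th
  letter.\<close>

lemma subst_infinite_fixed_snth:
  assumes "uniform_substitution l \<sigma>" "subst_infinite \<sigma> u = u" "j < l"
  shows "u !! (l * k + j) = \<sigma> [u !! k] ! j"
proof -
  have "length (\<sigma> [c]) = l" for c
    using assms(1) by (cases c) (auto simp: uniform_substitution_def)
  then have "flat (smap (\<lambda>c. \<sigma> [c]) u) !! (l * k + j) = smap (\<lambda>c. \<sigma> [c]) u !! k ! j"
    using assms(3) by (intro flat_snth_uniform) (auto simp: stream.set_map)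
  then show ?thesis using assms(2) by (simp add: subst_infinite_def)
qed

lemma pref_eq_take: "pref v = (\<lambda>j. take j v) ` {1..<length v}"
proof (intro equalityI subsetI)
  fix x assume "x \<in> pref v"
  then have x: "x \<noteq> []" "strict_prefix x v" by (auto simp: pref_def)
  then have "x = take (length x) v" by (auto simp: strict_prefix_def prefix_def)
  moreover have "length x \<in> {1..<length v}"
    using x prefix_length_less[of x v] by (auto simp: Suc_le_eq)
  ultimately show "x \<in> (\<lambda>j. take j v) ` {1..<length v}" by blast
next
  fix x assume "x \<in> (\<lambda>j. take j v) ` {1..<length v}"
  then obtain j where j: "1 \<le> j" "j < length v" "x = take j v" by auto
  then have "length x = j" by simp
  then have "x \<noteq> v" "x \<noteq> []" using j by auto
  then show "x \<in> pref v" using j by (simp add: pref_def strict_prefix_def take_is_prefix)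
qed

lemma delta1_eq_sum_take: "delta1 \<alpha> v = (\<Sum>j<length v. count_list (take j v) \<alpha>)"
proof -
  have "inj_on (\<lambda>j. take j v) {1..<length v}"
    by (rule inj_onI) (metis atLeastLessThan_iff length_take less_imp_le min.absorb2)
  then have "delta1 \<alpha> v = (\<Sum>j\<in>{1..<length v}. count_list (take j v) \<alpha>)"
    by (simp add: delta1_def pref_eq_take sum.reindex)
  \<comment> \<open>The added index \<open>j = 0\<close> stands for the empty prefix, which contains
    no letter.\<close>
  also have "\<dots> = (\<Sum>j<length v. count_list (take j v) \<alpha>)"
    by (rule sum.mono_neutral_left) (auto simp: not_le)
  finally show ?thesis .
qed

lemma sum_letters:
  fixes g :: "letter \<Rightarrow> real"
  shows "(\<Sum>i<length v. g (v ! i)) = count_list v La * (g La - g Lb) + length v * g Lb"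
proof (induction v)
  case (Cons c v)
  then show ?case
    by (cases c) (simp_all add: sum.lessThan_Suc_shift algebra_simps del: sum.lessThan_Suc)
qed simp

text \<open>This is where \<open>delta1\<close> enters. The last term depends only on the length, so
  for two words of equal length the sums differ by \<open>g La - g Lb\<close> times the difference
  of their \<open>delta1\<close>.\<close>

lemma sum_prefix_letters:
  fixes g :: "letter \<Rightarrow> real"
  shows "(\<Sum>j<length v. \<Sum>i<j. g (v ! i)) = delta1 La v * (g La - g Lb) + (\<Sum>j<length v. real j) * g Lb"
proof -
  have "(\<Sum>i<j. g (v ! i)) = count_list (take j v) La * (g La - g Lb) + j * g Lb"
    if "j < length v" for j
    using sum_letters[of g "take j v"] that by simp
  then show ?thesis by (simp add: sum.distrib sum_distrib_right delta1_eq_sum_take)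
qed

lemma length_eq_count_letters: "length v = count_list v La + count_list v Lb"
proof (induction v)
  case (Cons c v)
  then show ?case by (cases c) simp_all
qed simp

section \<open>Continuity and linear structure of the function space\<close>

lemma continuous_on_concatenation:
  assumes l: "l > 0" and ca: "continuous_on {0..l} fa" and cb: "continuous_on {0..l} fb"
    and conc: "concatenation_along l u fa fb f"
  shows "continuous_on {0..} f"
proof -
  have block: "continuous_on {l * real k..l * real (Suc k)} f" for k
  proof -
    define g where "g = (case u !! k of La \<Rightarrow> fa | Lb \<Rightarrow> fb)"
    have g: "continuous_on {0..l} g" unfolding g_def using ca cb by (cases "u !! k") auto
    have "continuous_on {l * real k..l * real (Suc k)} (\<lambda>x. g (x - l * real k))"
      by (rule continuous_on_compose2[OF g]) (auto intro!: continuous_intros simp: algebra_simps)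
    moreover have "f x = g (x - l * real k)" if "x \<in> {l * real k..l * real (Suc k)}" for x
    proof -
      have "x - l * real k \<in> {0..l}" using that by (auto simp: algebra_simps)
      then have "f ((x - l * real k) + l * real k) = g (x - l * real k)"
        using conc[unfolded concatenation_along_def, rule_format, of "x - l * real k" k]
        unfolding g_def by (cases "u !! k") auto
      then show ?thesis by simp
    qed
    ultimately show ?thesis by (subst continuous_on_cong[OF refl]) auto
  qed
  have init: "continuous_on {0..l * real n} f" for n
  proof (induction n)
    case (Suc n)
    have "{0..l * real (Suc n)} = {0..l * real n} \<union> {l * real n..l * real (Suc n)}"
      using l by (simp add: ivl_disj_un_two_touch)
    then show ?case using continuous_on_closed_Un[OF _ _ Suc block[of n]] by simp
  qed simp
  have "continuous (at x within {0..}) f" if "x \<ge> 0" for x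
  proof -
    obtain n where n: "x < real n * l" using l reals_Archimedean3 by blast
    have "continuous (at x within {0..l * real n}) f"
      using init[of n] that n by (auto simp: continuous_on_eq_continuous_within mult.commute)
    \<comment> \<open>Since \<open>x < l * n\<close>, the two sets agree near
      \<open>x\<close>.\<close>
    moreover have "at x within {0..l * real n} = at x within {0..}"
      by (rule at_within_nhd[of _ "{..<real n * l}"]) (use n in \<open>auto simp: mult.commute\<close>)
    ultimately show ?thesis by simp
  qed
  then show ?thesis by (simp add: continuous_on_eq_continuous_within)
qed

text \<open>Trades oriented Lebesgue integrals for gauge integrals over ordered endpoints, for which
  the linearity and shift rules apply directly. The concatenation clause is common to both sides and
  provides the continuity needed for the exchange.\<close>

lemma mem_fun_space_iff:
  assumes "l > 0"
  shows "f \<in> fun_space l u \<longleftrightarrow>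
    (\<forall>x<0. f x = 0) \<and>
    (\<forall>y\<ge>0. \<forall>x\<ge>y. (f has_integral f x - f y) {real l * y..real l * x}) \<and>
    (\<exists>fa fb. continuous_on {0..real l} fa \<and> continuous_on {0..real l} fb \<and>
             concatenation_along (real l) u fa fb f)" (is "_ \<longleftrightarrow> ?A \<and> ?H \<and> ?C")
proof -
  let ?I = "\<forall>x\<ge>0. \<forall>y\<ge>0. (LBINT t=ereal (real l * y)..ereal (real l * x). f t) = f x - f y"
  have "?I \<longleftrightarrow> ?H" if C: ?C
  proof -
    have "real l > 0" using assms by simp
    then have cont: "continuous_on {0..} f"
      using C by (elim exE conjE) (rule continuous_on_concatenation)
    have int: "(LBINT t=ereal (real l * y)..ereal (real l * x). f t) = integral {real l * y..real l * x} f"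
      "f integrable_on {real l * y..real l * x}" if "0 \<le> y" "y \<le> x" for x y
    proof -
      have sub: "continuous_on {real l * y..real l * x} f"
        using cont by (rule continuous_on_subset) (use that in auto)
      show "f integrable_on {real l * y..real l * x}" by (rule integrable_continuous_real[OF sub])
      show "(LBINT t=ereal (real l * y)..ereal (real l * x). f t) = integral {real l * y..real l * x} f"
        using that by (intro interval_integral_eq_integral borel_integrable_atLeastAtMost' sub)
          (auto intro: mult_left_mono)
    qed
    show ?thesis
    proof
      assume ?I
      then show ?H using int by (metis has_integral_integral order_trans)
    next
      assume H: ?H
      have le: "(LBINT t=ereal (real l * y)..ereal (real l * x). f t) = f x - f y" if "0 \<le> y" "y \<le> x" for x y
        using int(1)[OF that] H that by (metis integral_unique)
      show ?I
      proof (intro allI impI)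
        fix x y :: real assume "0 \<le> x" "0 \<le> y"
        then show "(LBINT t=ereal (real l * y)..ereal (real l * x). f t) = f x - f y"
          using le[of y x] le[of x y] interval_integral_endpoints_reverse[of "ereal (real l * y)" "ereal (real l * x)" f]
          by (cases "y \<le> x") auto
      qed
    qed
  qed
  then show ?thesis unfolding fun_space_def by blast
qed

lemma subspace_fun_space:
  assumes "l > 0"
  shows "subspace (fun_space l u)"
  unfolding subspace_def
proof (intro conjI ballI allI)
  show "0 \<in> fun_space l u"
  proof -
    have "concatenation_along (real l) u (\<lambda>_. 0) (\<lambda>_. 0) (\<lambda>_. 0)"
      by (simp add: concatenation_along_def split: letter.split)
    moreover have "continuous_on {0..real l} (\<lambda>_. 0 :: real)" by simp
    ultimately have "(\<lambda>_. 0) \<in> fun_space l u"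
      unfolding mem_fun_space_iff[OF assms]
      by (intro conjI exI[of _ "\<lambda>_. 0"]) simp_all
    then show ?thesis by (simp only: zero_fun_def)
  qed
next
  fix f g assume "f \<in> fun_space l u" "g \<in> fun_space l u"
  obtain fa fb where F: "\<forall>x<0. f x = 0"
    "\<forall>y\<ge>0. \<forall>x\<ge>y. (f has_integral f x - f y) {real l * y..real l * x}"
    "continuous_on {0..real l} fa" "continuous_on {0..real l} fb" "concatenation_along (real l) u fa fb f"
    using \<open>f \<in> fun_space l u\<close> unfolding mem_fun_space_iff[OF assms] by (elim conjE exE)
  obtain ga gb where G: "\<forall>x<0. g x = 0"
    "\<forall>y\<ge>0. \<forall>x\<ge>y. (g has_integral g x - g y) {real l * y..real l * x}"
    "continuous_on {0..real l} ga" "continuous_on {0..real l} gb" "concatenation_along (real l) u ga gb g"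
    using \<open>g \<in> fun_space l u\<close> unfolding mem_fun_space_iff[OF assms] by (elim conjE exE)
  have int: "((\<lambda>x. f x + g x) has_integral (f x + g x) - (f y + g y)) {real l * y..real l * x}"
    if "0 \<le> y" "y \<le> x" for x y
    using has_integral_add[OF F(2)[rule_format, OF that] G(2)[rule_format, OF that]] by (simp add: algebra_simps)
  have "concatenation_along (real l) u (\<lambda>x. fa x + ga x) (\<lambda>x. fb x + gb x) (\<lambda>x. f x + g x)"
    using F(5) G(5) unfolding concatenation_along_def by (auto split: letter.splits)
  moreover have "continuous_on {0..real l} (\<lambda>x. fa x + ga x)" "continuous_on {0..real l} (\<lambda>x. fb x + gb x)"
    using F(3,4) G(3,4) by (auto intro: continuous_intros)
  ultimately show "f + g \<in> fun_space l u"
    unfolding mem_fun_space_iff[OF assms] plus_fun_def using F(1) G(1) int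
    by (intro conjI exI[of _ "\<lambda>x. fa x + ga x"] exI[of _ "\<lambda>x. fb x + gb x"]) auto
next
  fix c :: real and f assume "f \<in> fun_space l u"
  obtain fa fb where F: "\<forall>x<0. f x = 0"
    "\<forall>y\<ge>0. \<forall>x\<ge>y. (f has_integral f x - f y) {real l * y..real l * x}"
    "continuous_on {0..real l} fa" "continuous_on {0..real l} fb" "concatenation_along (real l) u fa fb f"
    using \<open>f \<in> fun_space l u\<close> unfolding mem_fun_space_iff[OF assms] by (elim conjE exE)
  have int: "((\<lambda>x. c *\<^sub>R f x) has_integral c *\<^sub>R f x - c *\<^sub>R f y) {real l * y..real l * x}"
    if "0 \<le> y" "y \<le> x" for x y
    using has_integral_cmul[OF F(2)[rule_format, OF that], of c] by (simp add: algebra_simps)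
  have "concatenation_along (real l) u (\<lambda>x. c *\<^sub>R fa x) (\<lambda>x. c *\<^sub>R fb x) (\<lambda>x. c *\<^sub>R f x)"
    using F(5) unfolding concatenation_along_def by (auto split: letter.splits)
  moreover have "continuous_on {0..real l} (\<lambda>x. c *\<^sub>R fa x)" "continuous_on {0..real l} (\<lambda>x. c *\<^sub>R fb x)"
    using F(3,4) by (auto intro: continuous_intros)
  ultimately show "c *\<^sub>R f \<in> fun_space l u"
    unfolding mem_fun_space_iff[OF assms] scaleR_fun_def using F(1) int
    by (intro conjI exI[of _ "\<lambda>x. c *\<^sub>R fa x"] exI[of _ "\<lambda>x. c *\<^sub>R fb x"]) auto
qed

text \<open>\<open>T\<close> maps a basis of \<open>S\<close> injectively to an independent set,
  whose size is bounded by the dimension of the target. As \<open>dim\<close> is 0 for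
  infinite-dimensional spaces, the finite spanning set is part of the conclusion.\<close>

lemma finite_dim_le_of_linear_inj:
  fixes S :: "'a::real_vector set" and T :: "'a \<Rightarrow> 'b::euclidean_space"
  assumes S: "subspace S" and T: "linear T" and inj: "\<And>x. x \<in> S \<Longrightarrow> T x = 0 \<Longrightarrow> x = 0"
  shows "(\<exists>B. finite B \<and> S \<subseteq> span B) \<and> dim S \<le> DIM('b)"
proof -
  obtain B where B: "B \<subseteq> S" "independent B" "S \<subseteq> span B" "card B = dim S"
    by (rule basis_exists)
  have "span B \<subseteq> S" using B(1) S by (rule span_minimal)
  then have inj_T: "inj_on T (span B)"
    using linear_injective_on_subspace_0[OF T subspace_span] inj by blast
  have "independent (T ` B)"
    using linear_independent_injective_image[OF T B(2) inj_T] .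
  then have TB: "finite (T ` B)" "card (T ` B) \<le> DIM('b)" using independent_bound by auto
  have "inj_on T B" using inj_T by (rule inj_on_subset) (auto intro: span_base)
  then have "finite B" "card B \<le> DIM('b)" using TB by (auto simp: card_image dest: finite_imageD)
  then show ?thesis using B by auto
qed

section \<open>Consequences of the integral equation alone\<close>

locale rescaled_primitive =
  fixes l :: nat and f :: "real \<Rightarrow> real"
  assumes l_ge_2: "l \<ge> 2"
    and integral: "0 \<le> (y::real) \<Longrightarrow> y \<le> (x::real) \<Longrightarrow>
      (f has_integral f x - f y) {real l * y..real l * x}"
begin

text \<open>The increment over \<open>[c, c + s]\<close> is the integral of \<open>f\<close> over
  the dilated interval, so equal values at the scale \<open>l * s\<close> give equal increments at
  the scale \<open>s\<close>.\<close>

lemma increment_eq_of_rescaled_eq: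
  fixes a b s :: real
  assumes "a \<ge> 0" "b \<ge> 0" "s \<ge> 0"
    and eq: "\<And>t. t \<in> {0..real l * s} \<Longrightarrow> f (real l * a + t) = f (real l * b + t)"
  shows "f (a + s) - f a = f (b + s) - f b"
proof -
  have incr: "f (c + s) - f c = integral {0..real l * s} (\<lambda>t. f (real l * c + t))" if "c \<ge> 0" for c :: real
  proof -
    have "f (c + s) - f c = integral {real l * c..real l * (c + s)} f"
      using integral[of c "c + s"] assms(3) that by (simp add: integral_unique)
    also have "\<dots> = integral {0..real l * s} (\<lambda>t. f (t + real l * c))"
      using integral_shift_real_ivl[of "real l * c" "real l * c" "real l * (c + s)" f] by (simp add: algebra_simps)
    finally show ?thesis by (simp add: add.commute)
  qed
  have "integral {0..real l * s} (\<lambda>t. f (real l * a + t)) = integral {0..real l * s} (\<lambda>t. f (real l * b + t))"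
    by (rule integral_cong) (rule eq)
  then show ?thesis using incr[OF assms(1)] incr[OF assms(2)] by simp
qed

text \<open>Integrating \<open>f\<close> over \<open>[c, c + m]\<close> produces the increment from
  \<open>c / l\<close> to \<open>(c + m) / l\<close>; subtracting \<open>m * f c\<close> leaves the
  integral of \<open>f (c + s) - f c\<close>, which is the same for \<open>c = a\<close> and
  \<open>c = b\<close>.\<close>

lemma rescaled_increment_eq:
  fixes a b m :: real
  assumes "a \<ge> 0" "b \<ge> 0" "m \<ge> 0"
    and eq: "\<And>s. s \<in> {0..m} \<Longrightarrow> f (a + s) - f a = f (b + s) - f b"
  shows "f ((a + m) / real l) - f (a / real l) - m * f a = f ((b + m) / real l) - f (b / real l) - m * f b"
proof -
  have incr: "f ((c + m) / real l) - f (c / real l) - m * f c = integral {0..m} (\<lambda>s. f (c + s) - f c)"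
    if "c \<ge> 0" for c :: real
  proof -
    have "(f has_integral f ((c + m) / real l) - f (c / real l)) {c..c + m}"
      using integral[of "c / real l" "(c + m) / real l"] assms(3) that l_ge_2 by (simp add: divide_right_mono)
    then have "((\<lambda>s. f (s + c)) has_integral f ((c + m) / real l) - f (c / real l)) {0..m}"
      using has_integral_shift_real_ivl[of f _ c "c + m" c] by simp
    moreover have "((\<lambda>s. f c) has_integral m * f c) {0..m}"
      using has_integral_const_real[of "f c" 0 m] assms(3) by simp
    ultimately have "((\<lambda>s. f (s + c) - f c) has_integral
        f ((c + m) / real l) - f (c / real l) - m * f c) {0..m}"
      by (rule has_integral_diff)
    then show ?thesis by (simp add: integral_unique add.commute)
  qed
  have "integral {0..m} (\<lambda>s. f (a + s) - f a) = integral {0..m} (\<lambda>s. f (b + s) - f b)"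
    by (rule integral_cong) (rule eq)
  then show ?thesis using incr[OF assms(1)] incr[OF assms(2)] by simp
qed

end

section \<open>Propagation of block structure and zeros to finer scales\<close>

locale substitutive_primitive = rescaled_primitive +
  fixes w :: "letter \<Rightarrow> letter list" and u :: "letter stream"
  assumes length_w: "length (w c) = l"
    and count_w: "count_list (w La) La = count_list (w Lb) La"
    and delta_w: "int (delta1 La (w La)) - int (delta1 La (w Lb)) = 1"
    and u_snth: "j < l \<Longrightarrow> u !! (l * k + j) = w (u !! k) ! j"
begin

definition p :: nat where "p = count_list (w La) La"
definition q :: nat where "q = count_list (w La) Lb"

lemma count_w_La: "count_list (w c) La = p"
  using count_w by (cases c) (auto simp: p_def)

lemma p_add_q: "p + q = l"
  using length_eq_count_letters[of "w La"] length_w[of La] unfolding p_def q_def by linarith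

lemma count_w_Lb: "count_list (w c) Lb = q"
  using length_eq_count_letters[of "w c"] length_w[of c] count_w_La[of c] p_add_q by linarith

text \<open>With \<open>p = 0\<close> both images would be the same power of \<open>Lb\<close>,
  contradicting \<open>delta_w\<close>. The same argument with \<open>La\<close> gives
  \<open>q_pos\<close>.\<close>

lemma p_pos: "p > 0"
proof (rule ccontr)
  assume "\<not> p > 0"
  then have p: "count_list (w c) La = 0" for c using count_w_La by simp
  have "x = Lb" if "x \<in> set (w c)" for x c
    using that p[of c] unfolding count_list_0_iff by (metis letter.exhaust)
  then have "w c = replicate l Lb" for c using length_w[of c] by (auto intro!: replicate_eqI)
  then show False using delta_w by simp
qed

lemma q_pos: "q > 0"
proof (rule ccontr)
  assume "\<not> q > 0"
  then have q: "count_list (w c) Lb = 0" for c using count_w_Lb by simp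
  have "x = La" if "x \<in> set (w c)" for x c
    using that q[of c] unfolding count_list_0_iff by (metis letter.exhaust)
  then have "w c = replicate l La" for c using length_w[of c] by (auto intro!: replicate_eqI)
  then show False using delta_w by simp
qed

text \<open>Every image contains both letters, in particular the block with which \<open>u\<close>
  begins. This turns identities for the letters \<open>u !! k\<close> into identities for
  \<open>La\<close> and \<open>Lb\<close>.\<close>

lemma letter_occurs: "\<exists>k. u !! k = c"
proof -
  have "count_list (w (u !! 0)) c > 0"
    using p_pos q_pos by (cases c) (simp_all only: count_w_La count_w_Lb)
  then have "c \<in> set (w (u !! 0))" by (metis count_list_0_iff less_numeral_extra(3))
  then obtain j where "j < l" "w (u !! 0) ! j = c" using length_w by (metis in_set_conv_nth)
  then show ?thesis using u_snth[of j 0] by auto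
qed

text \<open>The block length \<open>M\<close> is a parameter because the property is carried from
  \<open>l\<close> down to all \<open>1 / l ^ n\<close>.\<close>

definition block_determined :: "real \<Rightarrow> bool" where
  "block_determined M \<longleftrightarrow>
     (\<forall>k k'. u !! k = u !! k' \<longrightarrow> (\<forall>s\<in>{0..M}. f (real k * M + s) = f (real k' * M + s)))"

text \<open>\<open>G\<close> is the total increment over a block of length \<open>m\<close>, and
  \<open>H\<close> is the integral over the block of the increment from its left end.\<close>

lemma increment_functions:
  fixes m :: real
  assumes bd: "block_determined (l * m)" and m: "m > 0"
  obtains G H :: "letter \<Rightarrow> real" where
    "\<And>k. f (real (Suc k) * m) - f (real k * m) = G (u !! k)"
    "\<And>k. f (real (Suc k) * m / l) - f (real k * m / l) - m * f (real k * m) = H (u !! k)"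
    "\<And>k k' s. u !! k = u !! k' \<Longrightarrow> s \<in> {0..m} \<Longrightarrow>
       f (real k * m + s) - f (real k * m) = f (real k' * m + s) - f (real k' * m)"
proof -
  have incr: "f (real k * m + s) - f (real k * m) = f (real k' * m + s) - f (real k' * m)"
    if "u !! k = u !! k'" "s \<in> {0..m}" for k k' s
  proof (rule increment_eq_of_rescaled_eq)
    fix t assume "t \<in> {0..l * s}"
    moreover have "l * s \<le> l * m" using that(2) by (simp add: mult_left_mono)
    ultimately have "t \<in> {0..l * m}" by simp
    then show "f (l * (real k * m) + t) = f (l * (real k' * m) + t)"
      using bd that(1) unfolding block_determined_def by (metis mult.left_commute)
  qed (use that m in auto)
  have "f (real (Suc k) * m) - f (real k * m) = f (real (Suc k') * m) - f (real k' * m)"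
    if "u !! k = u !! k'" for k k'
    using incr[OF that, of m] m by (simp add: algebra_simps)
  \<comment> \<open>A quantity that depends on \<open>k\<close> only through \<open>u !! k\<close>
    factors through \<open>u\<close>.\<close>
  then obtain G where G: "(\<lambda>k. f (real (Suc k) * m) - f (real k * m)) = G \<circ> (!!) u"
    using function_factors_left[of "(!!) u" "\<lambda>k. f (real (Suc k) * m) - f (real k * m)"] by blast
  have "f (real (Suc k) * m / l) - f (real k * m / l) - m * f (real k * m)
      = f (real (Suc k') * m / l) - f (real k' * m / l) - m * f (real k' * m)"
    if "u !! k = u !! k'" for k k'
    using rescaled_increment_eq[of "real k * m" "real k' * m" m] incr[OF that] m
    by (simp add: algebra_simps)
  then obtain H where H: "(\<lambda>k. f (real (Suc k) * m / l) - f (real k * m / l) - m * f (real k * m)) = H \<circ> (!!) u"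
    using function_factors_left[of "(!!) u"
        "\<lambda>k. f (real (Suc k) * m / l) - f (real k * m / l) - m * f (real k * m)"] by blast
  show ?thesis
  proof (rule that)
    show "f (real (Suc k) * m) - f (real k * m) = G (u !! k)" for k
      using fun_cong[OF G, of k] by (simp only: o_def)
    show "f (real (Suc k) * m / l) - f (real k * m / l) - m * f (real k * m) = H (u !! k)" for k
      using fun_cong[OF H, of k] by (simp only: o_def)
  qed (rule incr)
qed

text \<open>The result does not depend on \<open>k\<close>, because the images of both letters have
  the same letter counts.\<close>

lemma sum_block:
  fixes g :: "letter \<Rightarrow> real"
  shows "(\<Sum>j<l. g (u !! (l * k + j))) = p * g La + q * g Lb"
proof -
  have "(\<Sum>j<l. g (u !! (l * k + j))) = (\<Sum>j<length (w (u !! k)). g (w (u !! k) ! j))"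
    using length_w by (auto intro!: sum.cong simp: u_snth)
  also have "\<dots> = p * (g La - g Lb) + real l * g Lb"
    using sum_letters[of g "w (u !! k)"] by (simp only: length_w count_w_La)
  also have "real l = p + q" using p_add_q by simp
  finally show ?thesis by (simp add: algebra_simps)
qed

text \<open>A block of length \<open>l * m\<close> consists of \<open>l\<close> blocks of length
  \<open>m\<close>, so the increments telescope.\<close>

lemma long_increment:
  fixes m :: real and G :: "letter \<Rightarrow> real"
  assumes G: "\<And>k. f (real (Suc k) * m) - f (real k * m) = G (u !! k)"
  shows "f (real (Suc k) * (l * m)) - f (real k * (l * m)) = p * G La + q * G Lb"
proof -
  have "(\<Sum>j<l. G (u !! (l * k + j)))
      = (\<Sum>j<l. f (real (l * k + Suc j) * m) - f (real (l * k + j) * m))"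
    by (simp add: G[symmetric])
  also have "\<dots> = f (real (l * k + l) * m) - f (real (l * k) * m)"
    by (subst sum_lessThan_telescope) simp
  also have "real (l * k + l) * m = real (Suc k) * (l * m)" by (simp add: algebra_simps)
  also have "real (l * k) * m = real k * (l * m)" by simp
  finally show ?thesis by (simp only: sum_block)
qed

text \<open>One step down in scale. The value \<open>m = 1\<close> is excluded because the relation
  \<open>G La - G Lb = m * (G La - G Lb)\<close> is then empty.\<close>

lemma refine:
  fixes m :: real
  assumes bd: "block_determined (l * m)" and m: "m > 0" "m \<noteq> 1"
    and zero: "\<And>k. f (real k * (l * m)) = 0"
  shows "block_determined m \<and> (\<forall>k. f (real k * m) = 0)"
proof -
  obtain G H where G: "\<And>k. f (real (Suc k) * m) - f (real k * m) = G (u !! k)"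
    and H: "\<And>k. f (real (Suc k) * m / l) - f (real k * m / l) - m * f (real k * m) = H (u !! k)"
    and incr: "\<And>k k' s. u !! k = u !! k' \<Longrightarrow> s \<in> {0..m} \<Longrightarrow>
       f (real k * m + s) - f (real k * m) = f (real k' * m + s) - f (real k' * m)"
    using increment_functions[OF bd m(1)] by blast
  have pq: "p * G La + q * G Lb = 0"
    using long_increment[of m G, OF G, of 0] zero[of 1] zero[of 0] by simp
  \<comment> \<open>\<open>h\<close> collects all terms that do not depend on the letter
    \<open>u !! k\<close>; it cancels when the two letters are compared.\<close>
  define h where "h = p * H La + q * H Lb + m * ((\<Sum>j<l. real j) * G Lb)"
  have G_eq: "G (u !! k) = m * (delta1 La (w (u !! k)) * (G La - G Lb)) + h" for k
  proof -
    \<comment> \<open>\<open>f\<close> vanishes at the start of each long block, so its values at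
      the multiples of \<open>m\<close> are sums of \<open>G\<close> along a prefix of the image
      word.\<close>
    have partial_sum: "f (real (l * k + j) * m) = (\<Sum>i<j. G (w (u !! k) ! i))" if "j \<le> l" for j
    proof -
      have "(\<Sum>i<j. G (w (u !! k) ! i)) = (\<Sum>i<j. G (u !! (l * k + i)))"
        using that by (auto intro!: sum.cong simp: u_snth)
      also have "\<dots> = (\<Sum>i<j. f (real (l * k + Suc i) * m) - f (real (l * k + i) * m))"
        by (simp add: G[symmetric])
      also have "\<dots> = f (real (l * k + j) * m) - f (real (l * k) * m)"
        by (subst sum_lessThan_telescope) simp
      also have "f (real (l * k) * m) = 0" using zero[of k] by (simp add: algebra_simps)
      finally show ?thesis by simp
    qed
    \<comment> \<open>The block of length \<open>m\<close> is now cut into \<open>l\<close> pieces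
      of length \<open>m / l\<close>, whose increments are given by \<open>H\<close> and the values
      of \<open>f\<close> at the multiples of \<open>m\<close>.\<close>
    have "real (l * k + l) * m / l = real (Suc k) * m" "real (l * k) * m / l = real k * m"
      using l_ge_2 by (simp_all add: field_simps)
    then have "G (u !! k) = f (real (l * k + l) * m / l) - f (real (l * k) * m / l)"
      by (simp only: G)
    also have "\<dots> = (\<Sum>j<l. f (real (l * k + Suc j) * m / l) - f (real (l * k + j) * m / l))"
      by (subst sum_lessThan_telescope) simp
    also have "\<dots> = (\<Sum>j<l. m * (\<Sum>i<j. G (w (u !! k) ! i)) + H (u !! (l * k + j)))"
    proof (rule sum.cong)
      fix j assume "j \<in> {..<l}"
      then show "f (real (l * k + Suc j) * m / l) - f (real (l * k + j) * m / l)
          = m * (\<Sum>i<j. G (w (u !! k) ! i)) + H (u !! (l * k + j))"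
        using H[of "l * k + j"] partial_sum[of j] by simp
    qed simp
    also have "\<dots> = m * (\<Sum>j<l. \<Sum>i<j. G (w (u !! k) ! i)) + (p * H La + q * H Lb)"
      by (simp add: sum.distrib sum_block sum_distrib_left)
    also have "(\<Sum>j<l. \<Sum>i<j. G (w (u !! k) ! i))
        = delta1 La (w (u !! k)) * (G La - G Lb) + (\<Sum>j<l. real j) * G Lb"
      using sum_prefix_letters[of G "w (u !! k)"] by (simp add: length_w)
    finally show ?thesis by (simp add: h_def algebra_simps)
  qed
  have G_letter: "G c = m * (delta1 La (w c) * (G La - G Lb)) + h" for c
    using letter_occurs[of c] G_eq by metis
  have "real (delta1 La (w La)) = real (delta1 La (w Lb)) + 1" using delta_w by linarith
  then have "G La - G Lb = m * (G La - G Lb)"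
    using G_letter[of La] G_letter[of Lb] by (simp add: algebra_simps)
  then have eq: "G La = G Lb" using m(2) by simp
  have "real l * G La = 0" using pq eq by (simp add: algebra_simps flip: p_add_q)
  then have "G c = 0" for c using eq l_ge_2 by (cases c) auto
  then have "f (real (Suc k) * m) = f (real k * m)" for k using G[of k] by simp
  then have z: "f (real k * m) = 0" for k
    using zero[of 0] by (induction k) (simp_all del: of_nat_Suc)
  have "block_determined m"
    unfolding block_determined_def using incr z by (metis diff_zero)
  then show ?thesis using z by blast
qed

text \<open>Handles the scale \<open>m = 1\<close> left out by \<open>refine\<close>. Zeros at the
  multiples of \<open>l\<close> are not given here; they follow from the linear growth of
  \<open>f (k * l)\<close>, which boundedly many values forbid unless the slope is 0.\<close>

lemma block_determined_one:
  assumes bd: "block_determined l" and "f 0 = 0" "f 1 = 0"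
  shows "block_determined 1 \<and> (\<forall>k. f (real k) = 0)"
proof -
  obtain G where G: "\<And>k. f (real (Suc k)) - f (real k) = G (u !! k)"
    and incr: "\<And>k k' s. u !! k = u !! k' \<Longrightarrow> s \<in> {0..1} \<Longrightarrow>
       f (real k + s) - f (real k) = f (real k' + s) - f (real k')"
    using increment_functions[of 1] bd by (metis mult.right_neutral zero_less_one)
  define D where "D = p * G La + q * G Lb"
  have "f (real (Suc k) * l) - f (real k * l) = D" for k
    using long_increment[of 1 G k] G unfolding D_def by simp
  then have "f (real (Suc k) * l) = f (real k * l) + D" for k by (metis diff_eq_eq add.commute)
  then have lin: "f (real k * l) = real k * D" for k
    using assms(2) by (induction k) (simp_all add: algebra_simps del: of_nat_Suc, simp add: algebra_simps)
  have same: "real k * D = real k' * D" if "u !! k = u !! k'" for k k'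
    using bd[unfolded block_determined_def, rule_format, OF that, of 0] lin by simp
  \<comment> \<open>\<open>k D\<close> depends only on the letter \<open>u\<^sub>k\<close>, so it takes at most two values.\<close>
  have "u !! 0 = u !! 1 \<or> u !! 0 = u !! 2 \<or> u !! 1 = u !! 2"
    by (metis (full_types) letter.exhaust)
  then have D: "D = 0" using same[of 0 1] same[of 0 2] same[of 1 2] by auto
  \<comment> \<open>The hypothesis \<open>f 1 = 0\<close> removes the free parameter: one of the
    increments is 0, and \<open>D = 0\<close> with \<open>p\<close> and \<open>q\<close> positive
    forces the other to be 0.\<close>
  have "G (u !! 0) = 0" using G[of 0] assms by simp
  then have "G La = 0 \<and> G Lb = 0"
    using D p_pos q_pos unfolding D_def by (cases "u !! 0") auto
  then have "G c = 0" for c by (cases c) auto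
  then have "f (real (Suc k)) = f (real k)" for k using G[of k] by simp
  then have z: "f (real k) = 0" for k
    using assms(2) by (induction k) (simp_all del: of_nat_Suc)
  have "block_determined 1"
    unfolding block_determined_def mult_1_right
  proof (intro allI impI ballI)
    fix k k' and s :: real assume "u !! k = u !! k'" "s \<in> {0..1}"
    from incr[OF this] show "f (real k + s) = f (real k' + s)" by (simp only: z diff_zero)
  qed
  then show ?thesis using z by blast
qed

lemma zero_on_adic:
  assumes "block_determined l" "f 0 = 0" "f 1 = 0"
  shows "f (real k / real l ^ n) = 0"
proof -
  have "block_determined (1 / real l ^ n) \<and> (\<forall>k. f (real k * (1 / real l ^ n)) = 0)"
  proof (induction n)
    case 0
    then show ?case using block_determined_one[OF assms] by simp
  next
    case (Suc n)
    \<comment> \<open>All scales after the first are below 1, so the excluded value of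
      \<open>refine\<close> never recurs.\<close>
    have "real l ^ Suc n > 1" using l_ge_2 by (intro one_less_power) auto
    then have "0 < 1 / real l ^ Suc n" "1 / real l ^ Suc n \<noteq> 1" by auto
    moreover have "real l * (1 / real l ^ Suc n) = 1 / real l ^ n" using l_ge_2 by simp
    ultimately show ?case using Suc by (intro refine) simp_all
  qed
  then show ?thesis by simp
qed

lemma eq_zero:
  assumes bd: "block_determined l" "f 0 = 0" "f 1 = 0"
    and cont: "continuous_on {0..} f" and "x \<ge> 0"
  shows "f x = 0"
proof -
  \<comment> \<open>The \<open>l\<close>-adic truncations of \<open>x\<close> are zeros of
    \<open>f\<close> converging to \<open>x\<close> from below; \<open>nat\<close> is harmless as
    \<open>x\<close> is nonnegative.\<close>
  define a where "a n = real (nat \<lfloor>x * real l ^ n\<rfloor>) / real l ^ n" for n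
  have pos: "real l ^ n > 0" for n using l_ge_2 by simp
  have bounds: "x - (1 / l) ^ n \<le> a n" "a n \<le> x" for n
  proof -
    have a: "a n = of_int \<lfloor>x * real l ^ n\<rfloor> / real l ^ n" using \<open>x \<ge> 0\<close> by (simp add: a_def)
    show "a n \<le> x" unfolding a using pos[of n] by (simp add: divide_le_eq)
    have "x * real l ^ n - 1 \<le> of_int \<lfloor>x * real l ^ n\<rfloor>" by linarith
    then have "(x * real l ^ n - 1) / real l ^ n \<le> a n" unfolding a using pos[of n] by (simp add: divide_right_mono)
    then show "x - (1 / l) ^ n \<le> a n" using pos[of n] by (simp add: field_simps power_divide)
  qed
  have "norm (1 / real l) < 1" using l_ge_2 by simp
  then have "(\<lambda>n. (1 / real l) ^ n) \<longlonglongrightarrow> 0" by (rule LIMSEQ_power_zero)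
  then have "(\<lambda>n. x - (1 / real l) ^ n) \<longlonglongrightarrow> x - 0" by (rule tendsto_diff[OF tendsto_const])
  then have "a \<longlonglongrightarrow> x"
    using bounds by (intro tendsto_sandwich[of "\<lambda>n. x - (1 / real l) ^ n" a _ "\<lambda>n. x"]) auto
  then have "(\<lambda>n. f (a n)) \<longlonglongrightarrow> f x"
    by (rule continuous_on_tendsto_compose[OF cont]) (use \<open>x \<ge> 0\<close> in \<open>auto simp: a_def\<close>)
  moreover have "f (a n) = 0" for n unfolding a_def using zero_on_adic[OF bd] .
  ultimately show ?thesis by (simp add: LIMSEQ_const_iff)
qed

end

section \<open>Injectivity of the evaluation at 0 and 1, and the dimension bound\<close>

lemma fun_space_eq_zero:
  assumes "l \<ge> 2" "uniform_substitution l \<sigma>"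
    and "count_list (\<sigma> [La]) La = count_list (\<sigma> [Lb]) La"
    and "int (delta1 La (\<sigma> [La])) - int (delta1 La (\<sigma> [Lb])) = 1"
    and "subst_infinite \<sigma> u = u"
    and f: "f \<in> fun_space l u" "f 0 = 0" "f 1 = 0"
  shows "f = 0"
proof -
  have l: "l > 0" using assms(1) by simp
  obtain fa fb where
    neg: "\<forall>x<0. f x = 0"
    and int: "\<forall>y\<ge>0. \<forall>x\<ge>y. (f has_integral f x - f y) {real l * y..real l * x}"
    and c: "continuous_on {0..real l} fa" "continuous_on {0..real l} fb"
    and conc: "concatenation_along (real l) u fa fb f"
    using f(1) unfolding mem_fun_space_iff[OF l] by (elim conjE exE)
  interpret substitutive_primitive l f "\<lambda>c. \<sigma> [c]" u
  proof
    show "length (\<sigma> [c]) = l" for c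
      using assms(2) by (cases c) (auto simp: uniform_substitution_def)
    show "u !! (l * k + j) = \<sigma> [u !! k] ! j" if "j < l" for k j
      using subst_infinite_fixed_snth[OF assms(2,5) that] .
  qed (use assms int in auto)
  have cont: "continuous_on {0..} f" using continuous_on_concatenation[OF _ c conc] l by simp
  have "block_determined l"
    using conc unfolding block_determined_def concatenation_along_def
    by (simp add: add.commute mult.commute)
  \<comment> \<open>For negative \<open>x\<close> this is the convention of extending by 0.\<close>
  then have "f x = 0" for x using eq_zero[OF _ f(2,3) cont] neg by (cases "x \<ge> 0") auto
  then show ?thesis by (simp add: fun_eq_iff)
qed

theorem theorem1:
  fixes l :: nat
    and \<sigma> :: "letter list \<Rightarrow> letter list"
    and u :: "letter stream"
  assumes "l \<ge> 2"
    and "uniform_substitution l \<sigma>"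
    and "count_list (\<sigma> [La]) La = count_list (\<sigma> [Lb]) La"
    and "count_list (\<sigma> [La]) Lb = count_list (\<sigma> [Lb]) Lb"
    and "int (delta1 La (\<sigma> [La])) - int (delta1 La (\<sigma> [Lb])) = 1"
    and "subst_infinite \<sigma> u = u"
  shows "subspace (fun_space l u)
    \<and> (\<exists>B. finite B \<and> fun_space l u \<subseteq> span B)
    \<and> dim (fun_space l u) \<le> 2"
proof -
  define T :: "(real \<Rightarrow> real) \<Rightarrow> real \<times> real" where "T = (\<lambda>f. (f 0, f 1))"
  have sub: "subspace (fun_space l u)" using assms(1) by (intro subspace_fun_space) simp
  have T: "linear T" by (rule linearI) (simp_all add: T_def scaleR_fun_def)
  have "f = 0" if "f \<in> fun_space l u" "T f = 0" for f
    using fun_space_eq_zero[OF assms(1-3,5,6) that(1)] that(2) by (simp add: T_def zero_prod_def)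
  from finite_dim_le_of_linear_inj[OF sub T this] sub show ?thesis by simp
qed

end
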